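(* Fix $\epsilon>0$ independent of $n$ with $\epsilon\le 0.001$. For $k=n^{1/2+\epsilon}$ and $\ell\le n^{1/4-0.001}$, the norm of the degree-$\lfloor 0.001/\epsilon\rfloor$ likelihood ratio between $B(k,n,\ell,1/2)$ and $B(k,n,1/2)$ is $1+o(1)$ as $n\to\infty$. On the other hand, for $k=n^{1/2+\epsilon}$ and all $\ell$, the norm of the degree-$O(1/\epsilon)$ likelihood ratio between $B(k,n,\ell,1/2)$ and $B(k,n,1/2)$ is unbounded as $n\to\infty$.
   Context: $D_{\mathrm{null}}=B(k,n,1/2)$: bipartite graphs $H=(U,V,E)$ with $|U|=k$, $|V|=n$, each pair $\{u,v\}$ ($u\in U,v\in V$) an edge independently with probability $1/2$. $D_{\mathrm{planted}}=B(k,n,\ell,1/2)$: choose $S\subseteq U$ by including each vertex of $U$ independently with probability $\ell/k$; choose $P\subseteq V$ by including each vertex of $V$ independently with probability $(k-\ell)/n$; then independently include each pair $\{u,v\}$ ($u\in U,v\in V$) as an edge with probability $1$ if $u\in S,v\in P$; with probability $\frac{n/2-(k-\ell)}{n-(k-\ell)}$ if $u\in S,v\notin P$; and with probability $1/2$ otherwise. The degree-$D$ likelihood ratio $LR^{\le D}$ is the orthogonal projection, in $L^2(D_{\mathrm{null}})$, of the likelihood ratio $dD_{\mathrm{planted}}/dD_{\mathrm{null}}$ onto the space of polynomials of degree at most $D$ in the edge indicator variables; its norm is $\|LR^{\le D}\|=(\mathbb E_{D_{\mathrm{null}}}[(LR^{\le D})^2])^{1/2}$. $O(1/\epsilon)$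 denotes a sufficiently large constant multiple of $1/\epsilon$.
   Formalization: In the second part "all ℓ" is read as all integers ℓ with 1 ≤ ℓ < k (for all large n): for ℓ = 0 and for ℓ = k the planted and null distributions coincide, so the norm is exactly 1 and the claim fails. *)

theory Defs
  imports "HOL-Probability.Probability"
begin

text \<open>
  A bipartite graph with sides \<open>U = {..<k}\<close> and \<open>V = {..<n}\<close> is represented by its edge
  indicator \<open>H\<close>, where \<open>H (u, v)\<close> says that \<open>u \<in> U\<close> and \<open>v \<in> V\<close> are adjacent; the
  distributions below only charge indicators that are \<open>False\<close> outside \<open>U \<times> V\<close>.
\<close>

type_synonym bigraph = "nat \<times> nat \<Rightarrow> bool"

definition vertex_pairs :: "nat \<Rightarrow> nat \<Rightarrow> (nat \<times> nat) set" where
  "vertex_pairs k n = {..<k} \<times> {..<n}"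

definition null_pmf :: "nat \<Rightarrow> nat \<Rightarrow> bigraph pmf" where
  "null_pmf k n = Pi_pmf (vertex_pairs k n) False (\<lambda>_. bernoulli_pmf (1/2))"

text \<open>
  \<^const>\<open>bernoulli_pmf\<close> truncates its parameter to the unit interval. All parameters
  below already lie there whenever \<open>l \<le> k\<close>, \<open>0 < k\<close> and \<open>2 * (k - l) \<le> n\<close>.
\<close>

definition planted_edge_prob ::
    "nat \<Rightarrow> nat \<Rightarrow> nat \<Rightarrow> (nat \<Rightarrow> bool) \<Rightarrow> (nat \<Rightarrow> bool) \<Rightarrow> nat \<times> nat \<Rightarrow> real" where
  "planted_edge_prob k n l S P = (\<lambda>(u, v).
     if S u \<and> P v then 1
     else if S u then (real n / 2 - (real k - real l)) / (real n - (real k - real l))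
     else 1/2)"

definition planted_pmf :: "nat \<Rightarrow> nat \<Rightarrow> nat \<Rightarrow> bigraph pmf" where
  "planted_pmf k n l =
     bind_pmf (Pi_pmf {..<k} False (\<lambda>_. bernoulli_pmf (real l / real k))) (\<lambda>S.
     bind_pmf (Pi_pmf {..<n} False (\<lambda>_. bernoulli_pmf ((real k - real l) / real n))) (\<lambda>P.
       Pi_pmf (vertex_pairs k n) False (\<lambda>e. bernoulli_pmf (planted_edge_prob k n l S P e))))"

definition likelihood_ratio :: "nat \<Rightarrow> nat \<Rightarrow> nat \<Rightarrow> bigraph \<Rightarrow> real" where
  "likelihood_ratio k n l H = pmf (planted_pmf k n l) H / pmf (null_pmf k n) H"

text \<open>Exponent vectors of the monomials of total degree at most \<open>D\<close> in variables indexed by \<open>E\<close>.\<close>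

definition exponents :: "'e set \<Rightarrow> nat \<Rightarrow> ('e \<Rightarrow> nat) set" where
  "exponents E D = {a. (\<forall>e. e \<notin> E \<longrightarrow> a e = 0) \<and> (\<Sum>e\<in>E. a e) \<le> D}"

definition edge_polynomials :: "nat \<Rightarrow> nat \<Rightarrow> nat \<Rightarrow> (bigraph \<Rightarrow> real) set" where
  "edge_polynomials k n D =
     {\<lambda>H. \<Sum>a\<in>exponents (vertex_pairs k n) D. c a * (\<Prod>e\<in>vertex_pairs k n. of_bool (H e) ^ a e)
       | c :: (nat \<times> nat \<Rightarrow> nat) \<Rightarrow> real. True}"

definition null_inner :: "nat \<Rightarrow> nat \<Rightarrow> (bigraph \<Rightarrow> real) \<Rightarrow> (bigraph \<Rightarrow> real) \<Rightarrow> real" where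
  "null_inner k n f g = measure_pmf.expectation (null_pmf k n) (\<lambda>H. f H * g H)"

definition is_low_degree_projection ::
    "nat \<Rightarrow> nat \<Rightarrow> nat \<Rightarrow> (bigraph \<Rightarrow> real) \<Rightarrow> (bigraph \<Rightarrow> real) \<Rightarrow> bool" where
  "is_low_degree_projection k n D f g \<longleftrightarrow>
     g \<in> edge_polynomials k n D \<and>
     (\<forall>q\<in>edge_polynomials k n D. null_inner k n (\<lambda>H. f H - g H) q = 0)"

definition low_degree_LR :: "nat \<Rightarrow> nat \<Rightarrow> nat \<Rightarrow> nat \<Rightarrow> bigraph \<Rightarrow> real" where
  "low_degree_LR D k n l =
     (SOME g. is_low_degree_projection k n D (likelihood_ratio k n l) g)"

definition low_degree_LR_norm :: "nat \<Rightarrow> nat \<Rightarrow> nat \<Rightarrow> nat \<Rightarrow> real" where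
  "low_degree_LR_norm D k n l =
     sqrt (null_inner k n (low_degree_LR D k n l) (low_degree_LR D k n l))"

lemma finite_vertex_pairs [simp, intro]: "finite (vertex_pairs k n)"
  by (simp add: vertex_pairs_def)

text \<open>The sum in \<^const>\<open>edge_polynomials\<close> is a genuine finite sum.\<close>

lemma finite_exponents:
  assumes "finite E"
  shows "finite (exponents E D)"
proof (rule finite_subset)
  show "exponents E D \<subseteq> PiE_dflt E 0 (\<lambda>_. {..D})"
  proof
    fix a assume a: "a \<in> exponents E D"
    have "a e \<le> D" if "e \<in> E" for e
      using member_le_sum[of e E a] that assms a by (auto simp: exponents_def)
    then show "a \<in> PiE_dflt E 0 (\<lambda>_. {..D})"
      using a by (auto simp: PiE_dflt_def exponents_def)
  qed
  show "finite (PiE_dflt E 0 (\<lambda>_. {..D}))"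
    using assms by auto
qed

text \<open>
  The quotient of mass functions is the density of the planted distribution with respect to
  the null distribution: no planted mass is lost where the denominator vanishes.
\<close>

lemma pmf_planted_eq_likelihood_ratio:
  "pmf (planted_pmf k n l) H = likelihood_ratio k n l H * pmf (null_pmf k n) H"
proof (cases "\<forall>e. e \<notin> vertex_pairs k n \<longrightarrow> H e = False")
  case True
  then have "pmf (null_pmf k n) H = (\<Prod>e\<in>vertex_pairs k n. 1/2)"
    unfolding null_pmf_def by (subst pmf_Pi') auto
  then show ?thesis
    by (simp add: likelihood_ratio_def)
next
  case False
  have "set_pmf (planted_pmf k n l) \<subseteq> {f. \<forall>e. e \<notin> vertex_pairs k n \<longrightarrow> f e = False}"
    unfolding planted_pmf_def set_bind_pmf
    by (intro UN_least set_Pi_pmf_subset finite_vertex_pairs)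
  with False have "H \<notin> set_pmf (planted_pmf k n l)"
    by blast
  then have "pmf (planted_pmf k n l) H = 0"
    by (simp add: set_pmf_iff)
  then show ?thesis
    by (simp add: likelihood_ratio_def)
qed

end

theory Submission
  imports Defs "HOL-Real_Asymp.Real_Asymp"
begin

text \<open>
  The parity functions \<open>\<chi>\<^sub>A\<close> are orthonormal under the null distribution, and those with \<open>|A| \<le> D\<close>
  span the polynomials of degree at most \<open>D\<close>; so the squared norm is the sum over \<open>|A| \<le> D\<close> of the
  squared planted moments of \<open>\<chi>\<^sub>A\<close>. Write \<open>q = (k - l) / n\<close>. Averaged over \<open>P\<close>, every single edge is
  unbiased, so the moment vanishes as soon as some vertex of \<open>V\<close> has degree 1 in \<open>A\<close>; otherwise,
  if \<open>A\<close> touches \<open>a\<close> vertices of \<open>U\<close> and \<open>b\<close> vertices of \<open>V\<close>, it is at most of order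
  \<open>(l/k)\<^sup>a q\<^sup>b\<close>. For bounded \<open>D\<close> there are about \<open>k\<^sup>a n\<^sup>b\<close> such \<open>A\<close>, which together contribute
  \<open>(l\<^sup>2/k)\<^sup>a (q\<^sup>2 n)\<^sup>b\<close> up to a constant.

  If \<open>l \<le> n powr (1/4 - 0.001)\<close>, then \<open>k/l\<^sup>2\<close> beats \<open>(k\<^sup>2/n)\<^sup>b \<approx> n powr (2 \<epsilon> b)\<close>, because
  \<open>2 b \<le> |A| \<le> D\<close>. Conversely complete bipartite \<open>A\<close> suffice: sides \<open>(2, \<lceil>1/\<epsilon>\<rceil>)\<close> when \<open>l < k/2\<close>, so
  that \<open>q \<ge> k/(2n)\<close>, and sides \<open>(4, 1)\<close> when \<open>l \<ge> k/2\<close>, where \<open>q\<close> may be as small as \<open>1/n\<close>.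
\<close>

section \<open>Expectations over finite product distributions\<close>

text \<open>Independence of the coordinates factorises the expectation. Factors of either sign are
  covered, because edges are read as signs below.\<close>

lemma expectation_prod_Pi_pmf_real:
  fixes f :: "'a \<Rightarrow> 'b \<Rightarrow> real"
  assumes "finite I" "\<And>i. i \<in> I \<Longrightarrow> integrable (measure_pmf (p i)) (f i)"
  shows "measure_pmf.expectation (Pi_pmf I d p) (\<lambda>y. \<Prod>i\<in>I. f i (y i)) =
    (\<Prod>i\<in>I. measure_pmf.expectation (p i) (f i))"
proof -
  have comp: "measure_pmf (p i) = distr (measure_pmf (Pi_pmf I d p)) (count_space UNIV) (\<lambda>y. y i)"
    if "i \<in> I" for i
    using that assms(1) by (simp add: Pi_pmf_component flip: map_pmf_rep_eq)
  have int: "integrable (Pi_pmf I d p) (\<lambda>y. f i (y i))" if "i \<in> I" for i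
    using assms(2)[OF that] unfolding comp[OF that] by (subst (asm) integrable_distr_eq) auto
  have "measure_pmf.expectation (Pi_pmf I d p) (\<lambda>y. \<Prod>i\<in>I. f i (y i)) = (\<Prod>i\<in>I. measure_pmf.expectation (Pi_pmf I d p) (\<lambda>y. f i (y i)))"
    using assms(1) int
    by (intro prob_space.indep_vars_lebesgue_integral[OF measure_pmf.prob_space_axioms]
        prob_space.indep_vars_compose2[OF measure_pmf.prob_space_axioms indep_vars_Pi_pmf]) auto
  also have "\<dots> = (\<Prod>i\<in>I. measure_pmf.expectation (p i) (f i))"
    by (intro prod.cong refl) (subst comp, auto simp: integral_distr)
  finally show ?thesis .
qed

lemma expectation_bind_pmf_finite:
  fixes h :: "'b \<Rightarrow> real"
  assumes "finite (set_pmf p)" "\<And>x. x \<in> set_pmf p \<Longrightarrow> finite (set_pmf (f x))"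
  shows "measure_pmf.expectation (bind_pmf p f) h =
    measure_pmf.expectation p (\<lambda>x. measure_pmf.expectation (f x) h)"
  using assms by (subst pmf_expectation_bind[of "set_pmf p"]) (auto simp: integral_measure_pmf)

lemma finite_set_Pi_pmf:
  assumes "finite I" "\<And>i. i \<in> I \<Longrightarrow> finite (set_pmf (p i))"
  shows "finite (set_pmf (Pi_pmf I d p))"
  using assms by (auto simp: set_Pi_pmf intro!: finite_PiE_dflt)

lemma finite_set_null_pmf: "finite (set_pmf (null_pmf k n))"
  by (simp add: null_pmf_def finite_set_Pi_pmf)

section \<open>Parity functions and the space of low-degree polynomials\<close>

text \<open>These are the Fourier-Walsh characters of the Boolean cube.\<close>

definition walsh :: "'e set \<Rightarrow> ('e \<Rightarrow> bool) \<Rightarrow> real" where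
  "walsh A H = (\<Prod>e\<in>A. if H e then 1 else -1)"

lemma walsh_restrict:
  assumes "finite E" "A \<subseteq> E"
  shows "walsh A H = (\<Prod>e\<in>E. if e \<in> A then (if H e then 1 else -1) else 1)"
  unfolding walsh_def using assms by (subst prod.inter_restrict[symmetric]) (auto simp: Int_absorb1)

text \<open>A sign is twice the indicator minus 1; multiplying out shows that the character of
  \<open>A\<close> has degree at most \<open>card A\<close> in the edge indicators.\<close>

lemma walsh_expand:
  assumes "finite A"
  shows "walsh A H = (\<Sum>B\<in>Pow A. (2 ^ card B * (-1) ^ card (A - B)) * (\<Prod>e\<in>B. of_bool (H e)))"
proof -
  have "walsh A H = (\<Prod>e\<in>A. 2 * of_bool (H e) + (-1))"
    unfolding walsh_def by (intro prod.cong) auto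
  also have "\<dots> = (\<Sum>B\<in>Pow A. (\<Prod>e\<in>B. 2 * of_bool (H e)) * (\<Prod>e\<in>A - B. -1))"
    by (rule prod_add[OF assms])
  finally show ?thesis by (simp add: prod.distrib mult_ac)
qed

text \<open>The inverse change of basis: an indicator is half of the sign plus 1, so only characters
  of subsets of \<open>A\<close> occur.\<close>

lemma monomial_expand:
  assumes "finite A"
  shows "(\<Prod>e\<in>A. of_bool (H e)) = (\<Sum>B\<in>Pow A. (1/2) ^ card A * walsh B H)"
proof -
  have "(\<Prod>e\<in>A. of_bool (H e)) = (\<Prod>e\<in>A. 1/2 * ((if H e then 1 else -1) + (1::real)))"
    by (intro prod.cong) auto
  also have "\<dots> = (1/2) ^ card A * (\<Prod>e\<in>A. (if H e then 1 else -1) + (1::real))"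
    by (subst prod.distrib) simp
  also have "\<dots> = (1/2) ^ card A * (\<Sum>B\<in>Pow A. walsh B H)"
    by (subst prod_add[OF assms]) (simp add: walsh_def)
  finally show ?thesis by (simp add: sum_distrib_left)
qed

definition small_sets :: "'e set \<Rightarrow> nat \<Rightarrow> 'e set set" where
  "small_sets E D = {A. A \<subseteq> E \<and> card A \<le> D}"

lemma finite_small_sets: "finite E \<Longrightarrow> finite (small_sets E D)"
  by (rule finite_subset[of _ "Pow E"]) (auto simp: small_sets_def)

lemma monomial_in_edge_polynomials:
  assumes "A \<in> small_sets (vertex_pairs k n) D"
  shows "(\<lambda>H. \<Prod>e\<in>A. of_bool (H e)) \<in> edge_polynomials k n D"
proof -
  let ?E = "vertex_pairs k n"
  let ?a = "\<lambda>e. of_bool (e \<in> A) :: nat"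
  have A: "A \<subseteq> ?E" "card A \<le> D" using assms by (auto simp: small_sets_def)
  have fin: "finite (exponents ?E D)" by (simp add: finite_exponents)
  have sum_a: "sum ?a ?E = card A"
    using A(1) by (simp add: sum.If_cases of_bool_def Int_absorb1)
  have a: "?a \<in> exponents ?E D"
    using A by (auto simp: exponents_def sum_a)
  have mon: "(\<Prod>e\<in>A. of_bool (H e)) = (\<Prod>e\<in>?E. of_bool (H e) ^ ?a e :: real)" for H :: bigraph
    using A(1) by (intro prod.mono_neutral_cong_left) auto
  \<comment> \<open>The coefficient family is 1 at the exponent vector \<open>?a\<close> and 0
    elsewhere, so one summand survives.\<close>
  have "(\<Prod>e\<in>A. of_bool (H e)) = (\<Sum>a\<in>exponents ?E D.
      (if a = ?a then 1 else 0) * (\<Prod>e\<in>?E. of_bool (H e) ^ a e) :: real)" for H :: bigraph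
    unfolding mon using fin a
    by (subst sum.cong[OF refl, of _ _ "\<lambda>a. if a = ?a then \<Prod>e\<in>?E. of_bool (H e) ^ a e else 0"])
       (simp, simp only: sum.delta if_True)
  then show ?thesis unfolding edge_polynomials_def
    by (intro CollectI exI[of _ "\<lambda>a. if a = ?a then 1 else 0"]) auto
qed

lemma sum_in_edge_polynomials:
  assumes "finite I" "\<And>i. i \<in> I \<Longrightarrow> g i \<in> edge_polynomials k n D"
  shows "(\<lambda>H. \<Sum>i\<in>I. c i * g i H) \<in> edge_polynomials k n D"
proof -
  let ?E = "vertex_pairs k n"
  have "\<exists>d. \<forall>i\<in>I. g i = (\<lambda>H. \<Sum>a\<in>exponents ?E D. d i a * (\<Prod>e\<in>?E. of_bool (H e) ^ a e))"
    using assms(2) unfolding edge_polynomials_def by (intro bchoice) auto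
  then obtain d where d: "\<And>i. i \<in> I \<Longrightarrow>
      g i = (\<lambda>H. \<Sum>a\<in>exponents ?E D. d i a * (\<Prod>e\<in>?E. of_bool (H e) ^ a e))" by blast
  have "(\<Sum>i\<in>I. c i * g i H) =
      (\<Sum>a\<in>exponents ?E D. (\<Sum>i\<in>I. c i * d i a) * (\<Prod>e\<in>?E. of_bool (H e) ^ a e))" for H
    by (simp add: d sum_distrib_left sum_distrib_right mult.assoc) (rule sum.swap)
  then show ?thesis unfolding edge_polynomials_def
    by (intro CollectI exI[of _ "\<lambda>a. \<Sum>i\<in>I. c i * d i a"]) auto
qed

lemma walsh_in_edge_polynomials:
  assumes "A \<in> small_sets (vertex_pairs k n) D"
  shows "walsh A \<in> edge_polynomials k n D"
proof -
  have A: "finite A" "A \<subseteq> vertex_pairs k n" "card A \<le> D"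
    using assms finite_subset[OF _ finite_vertex_pairs] by (auto simp: small_sets_def)
  have "B \<in> small_sets (vertex_pairs k n) D" if "B \<in> Pow A" for B
    using that A card_mono[OF A(1), of B] by (auto simp: small_sets_def)
  then have "(\<lambda>H. \<Sum>B\<in>Pow A. (2 ^ card B * (-1) ^ card (A - B)) * (\<Prod>e\<in>B. of_bool (H e)))
      \<in> edge_polynomials k n D"
    using A(1) by (intro sum_in_edge_polynomials monomial_in_edge_polynomials) auto
  then show ?thesis
    unfolding walsh_expand[OF A(1), symmetric] .
qed

lemma null_inner_sum_right:
  "null_inner k n f (\<lambda>H. \<Sum>i\<in>I. c i * g i H) = (\<Sum>i\<in>I. c i * null_inner k n f (g i))"
  unfolding null_inner_def
  by (simp add: sum_distrib_left mult.left_commute integrable_measure_pmf_finite[OF finite_set_null_pmf])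

lemma null_inner_commute: "null_inner k n f g = null_inner k n g f"
  by (simp add: null_inner_def mult.commute)

lemma null_inner_diff_left:
  "null_inner k n (\<lambda>H. f H - g H) h = null_inner k n f h - null_inner k n g h"
  unfolding null_inner_def
  by (simp add: left_diff_distrib integrable_measure_pmf_finite[OF finite_set_null_pmf])

text \<open>Indicators are idempotent, so a monomial equals the squarefree product over its support
  \<open>T\<close>, and \<open>card T\<close> is at most the total degree. Expanding that product
  involves only characters of subsets of \<open>T\<close>.\<close>

lemma orthogonal_edge_polynomial:
  assumes "\<And>A. A \<in> small_sets (vertex_pairs k n) D \<Longrightarrow> null_inner k n f (walsh A) = 0"
    and "q \<in> edge_polynomials k n D"
  shows "null_inner k n f q = 0"
proof -
  let ?E = "vertex_pairs k n"
  obtain c where q: "q = (\<lambda>H. \<Sum>a\<in>exponents ?E D. c a * (\<Prod>e\<in>?E. of_bool (H e) ^ a e))"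
    using assms(2) by (auto simp: edge_polynomials_def)
  have "null_inner k n f (\<lambda>H. \<Prod>e\<in>?E. of_bool (H e) ^ a e) = 0" if a: "a \<in> exponents ?E D" for a
  proof -
    define T where "T = {e \<in> ?E. a e \<noteq> 0}"
    have fin: "finite T" by (simp add: T_def)
    have "card T = (\<Sum>e\<in>T. 1)" by simp
    also have "\<dots> \<le> (\<Sum>e\<in>T. a e)" by (intro sum_mono) (auto simp: T_def)
    also have "\<dots> \<le> (\<Sum>e\<in>?E. a e)" by (intro sum_mono2) (auto simp: T_def)
    also have "\<dots> \<le> D" using a by (simp add: exponents_def)
    finally have T: "card T \<le> D" .
    have "(\<lambda>H. \<Prod>e\<in>?E. of_bool (H e) ^ a e :: real) = (\<lambda>H. \<Prod>e\<in>T. of_bool (H e))"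
      by (intro ext prod.mono_neutral_cong_right) (auto simp: T_def)
    also have "\<dots> = (\<lambda>H. \<Sum>B\<in>Pow T. (1/2) ^ card T * walsh B H)"
      by (intro ext monomial_expand fin)
    finally have eq: "(\<lambda>H. \<Prod>e\<in>?E. of_bool (H e) ^ a e :: real) =
        (\<lambda>H. \<Sum>B\<in>Pow T. (1/2) ^ card T * walsh B H)" .
    have "null_inner k n f (walsh B) = 0" if "B \<in> Pow T" for B
      using that T card_mono[OF fin, of B] by (intro assms(1)) (auto simp: small_sets_def T_def)
    then show ?thesis unfolding eq null_inner_sum_right by simp
  qed
  then show ?thesis unfolding q null_inner_sum_right by simp
qed

text \<open>Edges are independent fair bits. An edge in exactly one of \<open>A\<close> and
  \<open>B\<close> contributes a sign of mean 0; every other edge contributes the constant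
  1.\<close>

lemma walsh_orthonormal:
  assumes "A \<subseteq> vertex_pairs k n" "B \<subseteq> vertex_pairs k n"
  shows "null_inner k n (walsh A) (walsh B) = of_bool (A = B)"
proof -
  let ?E = "vertex_pairs k n"
  let ?f = "\<lambda>e b. (if e \<in> A then (if b then 1 else -1) else 1) * (if e \<in> B then (if b then 1 else -1) else (1::real))"
  have "null_inner k n (walsh A) (walsh B) =
      measure_pmf.expectation (null_pmf k n) (\<lambda>H. \<Prod>e\<in>?E. ?f e (H e))"
    unfolding null_inner_def prod.distrib
    by (simp only: walsh_restrict[OF finite_vertex_pairs assms(1)] walsh_restrict[OF finite_vertex_pairs assms(2)])
  also have "\<dots> = (\<Prod>e\<in>?E. measure_pmf.expectation (bernoulli_pmf (1/2)) (?f e))"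
    unfolding null_pmf_def
    by (intro expectation_prod_Pi_pmf_real finite_vertex_pairs integrable_measure_pmf_finite) simp
  also have "\<dots> = (\<Prod>e\<in>?E. of_bool (e \<in> A \<longleftrightarrow> e \<in> B))"
    by (intro prod.cong) auto
  also have "\<dots> = of_bool (A = B)"
    using assms by (auto simp: prod_zero_iff of_bool_def)
  finally show ?thesis .
qed

section \<open>Planted moments and the norm as a sum of squares\<close>

text \<open>By \<open>null_inner_likelihood_ratio\<close> this is the Walsh coefficient of the
  likelihood ratio at \<open>A\<close>.\<close>

definition planted_moment :: "nat \<Rightarrow> nat \<Rightarrow> nat \<Rightarrow> (nat \<times> nat) set \<Rightarrow> real" where
  "planted_moment k n l A = measure_pmf.expectation (planted_pmf k n l) (walsh A)"

text \<open>Change of measure. The planted support lies inside the null support, so a sum over the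
  latter computes both expectations.\<close>

lemma null_inner_likelihood_ratio:
  "null_inner k n (likelihood_ratio k n l) f = measure_pmf.expectation (planted_pmf k n l) f"
proof -
  let ?S = "set_pmf (null_pmf k n)"
  have sub: "H \<in> ?S" if "H \<in> set_pmf (planted_pmf k n l)" for H
    using that pmf_planted_eq_likelihood_ratio[of k n l H] by (auto simp: set_pmf_iff)
  have "null_inner k n (likelihood_ratio k n l) f =
      (\<Sum>H\<in>?S. likelihood_ratio k n l H * f H * pmf (null_pmf k n) H)"
    unfolding null_inner_def by (rule integral_measure_pmf_real[OF finite_set_null_pmf])
  also have "\<dots> = (\<Sum>H\<in>?S. f H * pmf (planted_pmf k n l) H)"
    by (simp add: pmf_planted_eq_likelihood_ratio mult_ac)
  also have "\<dots> = measure_pmf.expectation (planted_pmf k n l) f"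
    using sub by (intro integral_measure_pmf_real[symmetric] finite_set_null_pmf)
  finally show ?thesis .
qed

text \<open>Parseval: truncating the Walsh expansion of the likelihood ratio to
  \<open>card A \<le> D\<close> gives a projection, and its coefficients are the planted
  moments.\<close>

theorem low_degree_LR_norm_eq:
  "low_degree_LR_norm D k n l =
    sqrt (\<Sum>A\<in>small_sets (vertex_pairs k n) D. (planted_moment k n l A)\<^sup>2)"
proof -
  let ?S = "small_sets (vertex_pairs k n) D"
  let ?LR = "likelihood_ratio k n l"
  let ?g = "low_degree_LR D k n l"
  define G where "G = (\<lambda>H. \<Sum>A\<in>?S. planted_moment k n l A * walsh A H)"
  have fin: "finite ?S" by (simp add: finite_small_sets)
  have G_in: "G \<in> edge_polynomials k n D"
    unfolding G_def by (intro sum_in_edge_polynomials walsh_in_edge_polynomials fin)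
  have G_walsh: "null_inner k n G (walsh A) = planted_moment k n l A" if A: "A \<in> ?S" for A
  proof -
    have "null_inner k n G (walsh A) = (\<Sum>B\<in>?S. planted_moment k n l B * null_inner k n (walsh A) (walsh B))"
      by (subst null_inner_commute) (simp add: G_def null_inner_sum_right)
    also have "\<dots> = (\<Sum>B\<in>?S. if B = A then planted_moment k n l B else 0)"
      using A by (intro sum.cong) (auto simp: small_sets_def walsh_orthonormal)
    finally show ?thesis using fin A by simp
  qed
  have G_proj: "is_low_degree_projection k n D ?LR G"
    unfolding is_low_degree_projection_def
  proof (intro conjI G_in ballI, rule orthogonal_edge_polynomial)
    fix A assume "A \<in> ?S"
    then show "null_inner k n (\<lambda>H. ?LR H - G H) (walsh A) = 0"
      by (simp add: null_inner_diff_left null_inner_likelihood_ratio G_walsh planted_moment_def)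
  qed
  have g_proj: "is_low_degree_projection k n D ?LR ?g"
    unfolding low_degree_LR_def using someI[of "is_low_degree_projection k n D ?LR" G] G_proj by blast
  \<comment> \<open>The projection picked by \<open>SOME\<close> is compared with \<open>G\<close>
    only through inner products with low-degree polynomials. Both are such polynomials themselves,
    so this settles the norm.\<close>
  have eq: "null_inner k n ?g q = null_inner k n G q" if "q \<in> edge_polynomials k n D" for q
    using that G_proj g_proj by (auto simp: is_low_degree_projection_def null_inner_diff_left)
  have "?g \<in> edge_polynomials k n D"
    using g_proj by (simp add: is_low_degree_projection_def)
  then have "null_inner k n ?g ?g = null_inner k n G G"
    using eq G_in by (metis null_inner_commute)
  also have "\<dots> = (\<Sum>A\<in>?S. planted_moment k n l A * null_inner k n G (walsh A))"
    by (subst (2) G_def) (rule null_inner_sum_right)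
  also have "\<dots> = (\<Sum>A\<in>?S. (planted_moment k n l A)\<^sup>2)"
    by (intro sum.cong) (auto simp: G_walsh power2_eq_square)
  finally show ?thesis by (simp add: low_degree_LR_norm_def)
qed

section \<open>Closed form of the planted moments\<close>

text \<open>
  The factor that a vertex of \<open>V\<close> of degree \<open>d\<close> in \<open>A\<close> contributes to the planted moment of \<open>A\<close>:
  an edge at \<open>S\<close> has mean sign \<open>1\<close> if the vertex is in \<open>P\<close> and \<open>- q / (1 - q)\<close> otherwise.
\<close>

definition right_weight :: "real \<Rightarrow> nat \<Rightarrow> real" where
  "right_weight q d = q + (1 - q) * (- (q / (1 - q))) ^ d"

lemma prod_group_power:
  assumes "finite A" "finite T" "g ` A \<subseteq> T"
  shows "(\<Prod>e\<in>A. h (g e)) = (\<Prod>v\<in>T. h v ^ card {e\<in>A. g e = v} :: real)"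
proof -
  have "(\<Prod>e\<in>A. h (g e)) = (\<Prod>v\<in>T. \<Prod>e\<in>{e\<in>A. g e = v}. h (g e))"
    by (rule prod.group[symmetric]) (use assms in auto)
  also have "\<dots> = (\<Prod>v\<in>T. \<Prod>e\<in>{e\<in>A. g e = v}. h v)"
    by (intro prod.cong) auto
  finally show ?thesis by simp
qed

text \<open>Given \<open>S\<close> and \<open>P\<close>, the edges are independent, and the mean
  sign of the edge \<open>(u, v)\<close> is the indicator of \<open>S u\<close> times 1 or
  \<open>- r\<close> according to \<open>P v\<close>. The conditional mean is thus a product over U
  times a product over V, and \<open>S\<close> and \<open>P\<close> are averaged separately.\<close>

lemma planted_moment_eq:
  assumes "l \<le> k" "0 < k" "0 < n" "2 * (k - l) \<le> n" "A \<subseteq> vertex_pairs k n"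
  defines "q \<equiv> (real k - real l) / real n"
  shows "planted_moment k n l A =
    (real l / real k) ^ card (fst ` A) * (\<Prod>v\<in>snd ` A. right_weight q (card {e\<in>A. snd e = v}))"
proof -
  let ?E = "vertex_pairs k n"
  let ?p = "planted_edge_prob k n l"
  define r where "r = q / (1 - q)"
  have fin: "finite A" using assms(5) finite_subset by blast
  have A: "fst ` A \<subseteq> {..<k}" "snd ` A \<subseteq> {..<n}" using assms(5) by (auto simp: vertex_pairs_def)
  have q: "0 \<le> q" "q \<le> 1/2" using assms(1-4) by (auto simp: q_def field_simps of_nat_diff)
  have kl: "real k - real l \<le> real n / 2" using assms(1,4) by linarith
  \<comment> \<open>For \<open>u\<close> in \<open>S\<close> and \<open>v\<close> outside
    \<open>P\<close>, an edge probability of \<open>(1 - r) / 2\<close> means a mean sign of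
    \<open>- r\<close>.\<close>
  have sec: "(real n / 2 - (real k - real l)) / (real n - (real k - real l)) = (1 - r) / 2"
  proof -
    have nz: "real n - (real k - real l) \<noteq> 0" using kl assms(3) by linarith
    have "1 - q = (real n - (real k - real l)) / real n"
      using assms(3) by (simp add: q_def diff_divide_distrib)
    then have "r = (real k - real l) / (real n - (real k - real l))"
      using assms(3) by (simp add: r_def q_def)
    then show ?thesis using nz by (simp add: divide_simps) algebra
  qed
  \<comment> \<open>Through \<open>q \<le> 1/2\<close> this keeps every edge probability in the unit
    interval, so that \<open>bernoulli_pmf\<close> truncates nothing.\<close>
  have r: "0 \<le> r" "r \<le> 1" using q by (auto simp: r_def field_simps)
  have p: "?p S P (u, v) = (if S u \<and> P v then 1 else if S u then (1 - r) / 2 else 1 / 2)" for S P u v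
    by (simp only: planted_edge_prob_def sec case_prod_conv)
  have p01: "0 \<le> ?p S P e" "?p S P e \<le> 1" for S P e
    using r by (cases e; auto simp: p)+
  have edges: "measure_pmf.expectation (Pi_pmf ?E False (\<lambda>e. bernoulli_pmf (?p S P e))) (walsh A) =
      (\<Prod>u<k. of_bool (S u) ^ card {e\<in>A. fst e = u}) *
      (\<Prod>v<n. (if P v then 1 else -r) ^ card {e\<in>A. snd e = v})" for S P
  proof -
    let ?f = "\<lambda>e b. if e \<in> A then (if b then 1 else -1) else (1::real)"
    have "measure_pmf.expectation (Pi_pmf ?E False (\<lambda>e. bernoulli_pmf (?p S P e))) (walsh A) =
      measure_pmf.expectation (Pi_pmf ?E False (\<lambda>e. bernoulli_pmf (?p S P e)))
        (\<lambda>H. \<Prod>e\<in>?E. ?f e (H e))"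
      by (intro arg_cong2[where f="lebesgue_integral"] refl ext walsh_restrict assms(5)) auto
    also have "\<dots> = (\<Prod>e\<in>?E. measure_pmf.expectation (bernoulli_pmf (?p S P e)) (?f e))"
      by (intro expectation_prod_Pi_pmf_real finite_vertex_pairs integrable_measure_pmf_finite) simp
    also have "\<dots> = (\<Prod>e\<in>?E. if e \<in> A then 2 * ?p S P e - 1 else 1)"
      by (intro prod.cong) (auto simp: p01)
    also have "\<dots> = (\<Prod>e\<in>A. 2 * ?p S P e - 1)"
      using assms(5) by (subst prod.inter_restrict[symmetric]) (auto simp: Int_absorb1)
    also have "\<dots> = (\<Prod>e\<in>A. of_bool (S (fst e)) * (if P (snd e) then 1 else -r))"
      by (intro prod.cong) (auto simp: p field_simps)
    also have "\<dots> = (\<Prod>e\<in>A. of_bool (S (fst e))) * (\<Prod>e\<in>A. if P (snd e) then 1 else -r)"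
      by (rule prod.distrib)
    also have "(\<Prod>e\<in>A. of_bool (S (fst e)) :: real) = (\<Prod>u<k. of_bool (S u) ^ card {e\<in>A. fst e = u})"
      by (rule prod_group_power[where h="\<lambda>u. of_bool (S u)"]) (use fin A in auto)
    also have "(\<Prod>e\<in>A. if P (snd e) then 1 else -r) = (\<Prod>v<n. (if P v then 1 else -r) ^ card {e\<in>A. snd e = v})"
      by (rule prod_group_power[where h="\<lambda>v. if P v then 1 else -r"]) (use fin A in auto)
    finally show ?thesis .
  qed
  have left: "measure_pmf.expectation (Pi_pmf {..<k} False (\<lambda>_. bernoulli_pmf (real l / real k)))
      (\<lambda>S. \<Prod>u<k. of_bool (S u) ^ card {e\<in>A. fst e = u}) = (real l / real k) ^ card (fst ` A)"
  proof -
    have "measure_pmf.expectation (Pi_pmf {..<k} False (\<lambda>_. bernoulli_pmf (real l / real k)))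
      (\<lambda>S. \<Prod>u<k. of_bool (S u) ^ card {e\<in>A. fst e = u}) =
      (\<Prod>u<k. measure_pmf.expectation (bernoulli_pmf (real l / real k))
        (\<lambda>b. of_bool b ^ card {e\<in>A. fst e = u}) :: real)"
      by (rule expectation_prod_Pi_pmf_real[where f="\<lambda>u b. of_bool b ^ card {e\<in>A. fst e = u}"])
         (auto intro: integrable_measure_pmf_finite)
    \<comment> \<open>An indicator to a positive power is itself and to the power 0 is 1: a touched
      vertex counts once, whatever its degree.\<close>
    also have "\<dots> = (\<Prod>u<k. if u \<in> fst ` A then real l / real k else 1)"
    proof (intro prod.cong refl)
      fix u
      have "card {e\<in>A. fst e = u} = 0 \<longleftrightarrow> u \<notin> fst ` A"
        using fin by (auto simp: image_iff)
      then show "measure_pmf.expectation (bernoulli_pmf (real l / real k))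
        (\<lambda>b. of_bool b ^ card {e\<in>A. fst e = u}) = (if u \<in> fst ` A then real l / real k else 1)"
        using assms(1,2) by (subst integral_bernoulli_pmf) (auto simp: power_0_left)
    qed
    also have "\<dots> = (\<Prod>u\<in>fst ` A. real l / real k)"
      using A by (subst prod.inter_restrict[symmetric]) (auto simp: Int_absorb1)
    finally show ?thesis by simp
  qed
  have right: "measure_pmf.expectation (Pi_pmf {..<n} False (\<lambda>_. bernoulli_pmf q))
      (\<lambda>P. \<Prod>v<n. (if P v then 1 else -r) ^ card {e\<in>A. snd e = v}) =
      (\<Prod>v\<in>snd ` A. right_weight q (card {e\<in>A. snd e = v}))"
  proof -
    have "measure_pmf.expectation (Pi_pmf {..<n} False (\<lambda>_. bernoulli_pmf q))
      (\<lambda>P. \<Prod>v<n. (if P v then 1 else -r) ^ card {e\<in>A. snd e = v}) =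
      (\<Prod>v<n. measure_pmf.expectation (bernoulli_pmf q)
        (\<lambda>b. (if b then 1 else -r) ^ card {e\<in>A. snd e = v}))"
      by (rule expectation_prod_Pi_pmf_real
            [where f="\<lambda>v b. (if b then 1 else -r) ^ card {e\<in>A. snd e = v}"])
         (auto intro: integrable_measure_pmf_finite)
    also have "\<dots> = (\<Prod>v<n. right_weight q (card {e\<in>A. snd e = v}))"
      using q by (intro prod.cong refl) (simp add: right_weight_def r_def)
    \<comment> \<open>An untouched vertex of V has degree 0 and weight
      \<open>q + (1 - q) = 1\<close>.\<close>
    also have "\<dots> = (\<Prod>v\<in>snd ` A. right_weight q (card {e\<in>A. snd e = v}))"
    proof (intro prod.mono_neutral_right ballI)
      fix v assume "v \<in> {..<n} - snd ` A"
      then have "{e\<in>A. snd e = v} = {}" by force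
      then have "card {e\<in>A. snd e = v} = 0" by (simp only: card.empty)
      then show "right_weight q (card {e\<in>A. snd e = v}) = 1"
        by (simp only: right_weight_def power_0) simp
    qed (use A in auto)
    finally show ?thesis .
  qed
  have "planted_moment k n l A =
    measure_pmf.expectation (Pi_pmf {..<k} False (\<lambda>_. bernoulli_pmf (real l / real k))) (\<lambda>S.
    measure_pmf.expectation (Pi_pmf {..<n} False (\<lambda>_. bernoulli_pmf q)) (\<lambda>P.
    measure_pmf.expectation (Pi_pmf ?E False (\<lambda>e. bernoulli_pmf (?p S P e))) (walsh A)))"
    unfolding planted_moment_def planted_pmf_def q_def
    by (simp add: expectation_bind_pmf_finite finite_set_Pi_pmf)
  then show ?thesis by (simp only: edges left right integral_mult_right_zero integral_mult_left_zero)
qed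

text \<open>The edge probability outside \<open>P\<close> is tuned so that \<open>q\<close> and
  \<open>(1 - q) * (q / (1 - q))\<close> cancel. This is what makes a vertex of degree 1 in V kill
  the moment.\<close>

lemma right_weight_1: "q \<noteq> 1 \<Longrightarrow> right_weight q 1 = 0"
  by (simp add: right_weight_def)

text \<open>An even power makes the contribution from outside \<open>P\<close> nonnegative, hence
  the even left side in the lower bound.\<close>

lemma right_weight_even_ge:
  assumes "0 \<le> q" "q \<le> 1" "even d"
  shows "q \<le> right_weight q d"
  using assms by (simp add: right_weight_def)

text \<open>With \<open>r = q / (1 - q) \<le> 1\<close>, positive powers of \<open>r\<close> are at
  most \<open>r\<close>, and \<open>(1 - q) * r = q\<close>. So both summands are at most
  \<open>q\<close> in absolute value.\<close>

lemma abs_right_weight_le: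
  assumes "0 \<le> q" "q \<le> 1/2" "2 \<le> d"
  shows "\<bar>right_weight q d\<bar> \<le> 2 * q"
proof -
  let ?r = "q / (1 - q)"
  have r: "0 \<le> ?r" "?r \<le> 1" using assms by (auto simp: field_simps)
  have "\<bar>right_weight q d\<bar> \<le> q + \<bar>(1 - q) * (- ?r) ^ d\<bar>"
    using assms unfolding right_weight_def by linarith
  also have "\<bar>(1 - q) * (- ?r) ^ d\<bar> = (1 - q) * ?r ^ d"
    using assms r by (simp add: abs_mult power_abs)
  also have "\<dots> \<le> (1 - q) * ?r ^ 1"
    using assms r by (intro mult_left_mono power_decreasing) auto
  also have "(1 - q) * ?r ^ 1 = q" using assms by simp
  finally show ?thesis by simp
qed

lemma fst_snd_image_subset_Times: "A \<subseteq> fst ` A \<times> snd ` A"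
  by (auto simp: image_iff) (force+)

section \<open>Lower bound from complete bipartite edge sets\<close>

text \<open>Only the edge sets \<open>X \<times> Y\<close> with \<open>card X = a\<close> and
  \<open>card Y = b\<close> are kept. Every vertex of \<open>Y\<close> then has the even degree
  \<open>a\<close>, hence weight at least \<open>q\<close>.\<close>

lemma low_degree_LR_norm_ge:
  assumes "l \<le> k" "0 < k" "0 < n" "2 * (k - l) \<le> n"
    and "even a" "0 < a" "0 < b" "a * b \<le> D"
  shows "real (k choose a) * real (n choose b) * (real l / real k) ^ (2 * a)
      * ((real k - real l) / real n) ^ (2 * b) \<le> (low_degree_LR_norm D k n l)\<^sup>2"
proof -
  define q where "q = (real k - real l) / real n"
  define T where "T = {X. X \<subseteq> {..<k} \<and> card X = a} \<times> {Y. Y \<subseteq> {..<n} \<and> card Y = b}"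
  let ?S = "small_sets (vertex_pairs k n) D"
  let ?c = "(real l / real k) ^ (2 * a) * q ^ (2 * b)"
  have q: "0 \<le> q" "q \<le> 1" using assms(1-4) by (auto simp: q_def field_simps of_nat_diff)
  have img: "fst ` (X \<times> Y) = X" "snd ` (X \<times> Y) = Y" if "(X, Y) \<in> T" for X Y
    using that assms(6,7) by (auto simp: T_def)
  \<comment> \<open>Nonempty sides can be read off the product, so different pairs give different
    edge sets.\<close>
  have inj: "inj_on (\<lambda>(X, Y). X \<times> Y) T"
    by (rule inj_on_inverseI[of _ "\<lambda>A. (fst ` A, snd ` A)"])
       (auto simp: img simp del: fst_image_times snd_image_times)
  have sub: "(\<lambda>(X, Y). X \<times> Y) ` T \<subseteq> ?S"
    using assms(8) by (auto simp: T_def small_sets_def vertex_pairs_def card_cartesian_product)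
  have moment: "?c \<le> (planted_moment k n l (X \<times> Y))\<^sup>2" if XY: "(X, Y) \<in> T" for X Y
  proof -
    have "X \<times> Y \<subseteq> vertex_pairs k n" using XY by (auto simp: T_def vertex_pairs_def)
    then have "planted_moment k n l (X \<times> Y) = (real l / real k) ^ card X *
        (\<Prod>v\<in>Y. right_weight q (card {e\<in>X \<times> Y. snd e = v}))"
      using planted_moment_eq[OF assms(1-4)] by (simp only: q_def img[OF XY])
    also have "(\<Prod>v\<in>Y. right_weight q (card {e\<in>X \<times> Y. snd e = v})) = (\<Prod>v\<in>Y. right_weight q a)"
    proof (intro prod.cong refl)
      fix v assume "v \<in> Y"
      then have "{e\<in>X \<times> Y. snd e = v} = X \<times> {v}" by auto
      then show "right_weight q (card {e\<in>X \<times> Y. snd e = v}) = right_weight q a"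
        using XY by (simp add: T_def card_cartesian_product)
    qed
    finally have "planted_moment k n l (X \<times> Y) = (real l / real k) ^ a * right_weight q a ^ b"
      using XY by (simp add: T_def)
    moreover have "(real l / real k) ^ a * q ^ b \<le> (real l / real k) ^ a * right_weight q a ^ b"
      using q assms(5) by (intro mult_left_mono power_mono right_weight_even_ge) auto
    moreover have "0 \<le> (real l / real k) ^ a * q ^ b" using q by simp
    ultimately have "((real l / real k) ^ a * q ^ b)\<^sup>2 \<le> (planted_moment k n l (X \<times> Y))\<^sup>2"
      by (metis power_mono)
    then show ?thesis by (simp add: power_mult_distrib mult.commute flip: power_mult)
  qed
  have "card T = (k choose a) * (n choose b)"
    by (simp add: T_def card_cartesian_product n_subsets)
  then have "real (k choose a) * real (n choose b) * ?c = (\<Sum>XY\<in>T. ?c)" by simp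
  also have "\<dots> \<le> (\<Sum>XY\<in>T. (planted_moment k n l (case XY of (X, Y) \<Rightarrow> X \<times> Y))\<^sup>2)"
    by (intro sum_mono) (auto intro: moment)
  also have "\<dots> = (\<Sum>A\<in>(\<lambda>(X, Y). X \<times> Y) ` T. (planted_moment k n l A)\<^sup>2)"
    by (simp add: sum.reindex[OF inj] o_def)
  also have "\<dots> \<le> (\<Sum>A\<in>?S. (planted_moment k n l A)\<^sup>2)"
    using sub by (intro sum_mono2 finite_small_sets finite_vertex_pairs) auto
  also have "\<dots> = (low_degree_LR_norm D k n l)\<^sup>2"
    by (simp add: low_degree_LR_norm_eq sum_nonneg)
  finally show ?thesis by (simp add: q_def mult.assoc)
qed

section \<open>Upper bound by the numbers of touched vertices\<close>

text \<open>Either some vertex of V has degree 1 and the moment vanishes, or all touched vertices of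
  V have degree at least 2. In the second case they number at most half of \<open>card A\<close>,
  each with weight at most \<open>2 * q\<close>.\<close>

lemma planted_moment_sq_le:
  assumes "l \<le> k" "0 < k" "0 < n" "2 * (k - l) \<le> n" "A \<subseteq> vertex_pairs k n"
  defines "q \<equiv> (real k - real l) / real n"
  shows "(planted_moment k n l A)\<^sup>2 \<le> of_bool (2 * card (snd ` A) \<le> card A) *
    ((real l / real k) ^ (2 * card (fst ` A)) * (2 * q) ^ (2 * card (snd ` A)))"
proof -
  define d where "d v = card {e\<in>A. snd e = v}" for v
  have fin: "finite A" using assms(5) finite_subset by blast
  have q: "0 \<le> q" "q \<le> 1/2" using assms(1-4) by (auto simp: q_def field_simps of_nat_diff)
  have m: "planted_moment k n l A =
      (real l / real k) ^ card (fst ` A) * (\<Prod>v\<in>snd ` A. right_weight q (d v))"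
    using assms(1-5) by (simp add: planted_moment_eq q_def d_def)
  show ?thesis
  proof (cases "\<exists>v\<in>snd ` A. d v = 1")
    case True
    then have "(\<Prod>v\<in>snd ` A. right_weight q (d v)) = 0"
      using q fin right_weight_1[of q] by (intro prod_zero) (auto simp del: One_nat_def intro!: bexI)
    then show ?thesis using q by (simp add: m)
  next
    case False
    have "d v \<noteq> 0" if "v \<in> snd ` A" for v
      using that fin by (auto simp: d_def)
    with False have d2: "2 \<le> d v" if "v \<in> snd ` A" for v
      using that by (metis One_nat_def less_2_cases not_le)
    have "2 * card (snd ` A) = (\<Sum>v\<in>snd ` A. 2)" by simp
    also have "\<dots> \<le> (\<Sum>v\<in>snd ` A. d v)" by (intro sum_mono d2)
    also have "\<dots> = card A"
      using sum.group[of A "snd ` A" snd "\<lambda>_. 1 :: nat"] fin by (simp add: d_def)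
    finally have card: "2 * card (snd ` A) \<le> card A" .
    have "\<bar>\<Prod>v\<in>snd ` A. right_weight q (d v)\<bar> \<le> (\<Prod>v\<in>snd ` A. 2 * q)"
      unfolding abs_prod by (intro prod_mono conjI abs_right_weight_le d2) (use q in auto)
    then have "\<bar>planted_moment k n l A\<bar> \<le>
        (real l / real k) ^ card (fst ` A) * (2 * q) ^ card (snd ` A)"
      unfolding m abs_mult by (auto intro!: mult_mono)
    then have "(planted_moment k n l A)\<^sup>2 \<le>
        ((real l / real k) ^ card (fst ` A) * (2 * q) ^ card (snd ` A))\<^sup>2"
      by (metis abs_ge_zero power2_abs power_mono)
    then show ?thesis using card by (simp add: power_mult_distrib mult.commute flip: power_mult)
  qed
qed

lemma sum_subsets_card:
  assumes "finite U" "finite B"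
  shows "(\<Sum>X\<in>{X. X \<subseteq> U \<and> card X \<in> B}. f (card X)) = (\<Sum>a\<in>B. real (card U choose a) * f a)"
proof -
  have "(\<Sum>X\<in>{X. X \<subseteq> U \<and> card X \<in> B}. f (card X)) =
      (\<Sum>a\<in>B. \<Sum>X\<in>{X\<in>{X. X \<subseteq> U \<and> card X \<in> B}. card X = a}. f (card X))"
    using assms by (intro sum.group[symmetric]) auto
  also have "\<dots> = (\<Sum>a\<in>B. \<Sum>X\<in>{X. X \<subseteq> U \<and> card X = a}. f a)"
    by (intro sum.cong) auto
  finally show ?thesis using assms(1) by (simp add: n_subsets)
qed

lemma binomial_le_power: "(n choose r) \<le> n ^ r"
  by (cases "r \<le> n") (auto simp: binomial_le_pow binomial_eq_0)

lemma sum_subsets_power_le: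
  fixes w :: real
  assumes "finite B" "0 \<le> w"
  shows "(\<Sum>X\<in>{X. X \<subseteq> {..<m} \<and> card X \<in> B}. w ^ card X) \<le> (\<Sum>a\<in>B. (real m * w) ^ a)"
proof -
  have "(\<Sum>X\<in>{X. X \<subseteq> {..<m} \<and> card X \<in> B}. w ^ card X) = (\<Sum>a\<in>B. real (m choose a) * w ^ a)"
    using sum_subsets_card[of "{..<m}" B "\<lambda>a. w ^ a"] assms(1) by simp
  also have "\<dots> \<le> (\<Sum>a\<in>B. real (m ^ a) * w ^ a)"
    using assms(2) by (intro sum_mono mult_right_mono) (simp_all add: binomial_le_power del: of_nat_power)
  finally show ?thesis by (simp add: power_mult_distrib)
qed

text \<open>The empty set contributes exactly 1. The other edge sets are grouped by their pairs of
  touched vertex sets; group sizes are bounded in terms of \<open>D\<close>, and the remaining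
  double sum splits into a sum over U times a sum over V.\<close>

lemma low_degree_LR_norm_sq_le:
  assumes "l \<le> k" "0 < k" "0 < n" "2 * (k - l) \<le> n"
    and "(real l)\<^sup>2 \<le> real k" "real n \<le> 4 * (real k)\<^sup>2"
  shows "(low_degree_LR_norm D k n l)\<^sup>2 \<le>
    1 + 2 ^ (D * D) * (real D * ((real l)\<^sup>2 / real k)) *
      (real (D + 1) * (4 * (real k)\<^sup>2 / real n) ^ (D div 2))"
    and "1 \<le> (low_degree_LR_norm D k n l)\<^sup>2"
proof -
  define q where "q = (real k - real l) / real n"
  define x where "x = (real l)\<^sup>2 / real k"
  define y where "y = 4 * (real k)\<^sup>2 / real n"
  define t :: "nat set \<times> nat set \<Rightarrow> real" where
    "t = (\<lambda>(X, Y). ((real l / real k)\<^sup>2) ^ card X * ((2 * q)\<^sup>2) ^ card Y)"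
  \<comment> \<open>A nonempty edge set touches U, which later yields the decisive factor
    \<open>x\<close>. It touches at most half as many vertices of V as it has edges, hence
    \<open>D div 2\<close> in \<open>TY\<close>.\<close>
  define TX where "TX = {X. X \<subseteq> {..<k} \<and> card X \<in> {1..D}}"
  define TY where "TY = {Y. Y \<subseteq> {..<n} \<and> card Y \<in> {..D div 2}}"
  define F where "F = {A \<in> small_sets (vertex_pairs k n) D - {{}}. 2 * card (snd ` A) \<le> card A}"
  let ?S = "small_sets (vertex_pairs k n) D"
  have finS: "finite ?S" by (simp add: finite_small_sets)
  have finF: "finite F" using finS by (simp add: F_def)
  have finT: "finite TX" "finite TY" by (auto simp: TX_def TY_def)
  have q: "0 \<le> q" using assms(1) by (simp add: q_def)
  have moment0: "planted_moment k n l {} = 1"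
    by (simp add: planted_moment_def walsh_def[abs_def])
  have split: "(low_degree_LR_norm D k n l)\<^sup>2 = 1 + (\<Sum>A\<in>?S - {{}}. (planted_moment k n l A)\<^sup>2)"
  proof -
    have "{} \<in> ?S" by (simp add: small_sets_def)
    then show ?thesis
      using finS by (simp add: low_degree_LR_norm_eq sum_nonneg sum.remove moment0)
  qed
  then show "1 \<le> (low_degree_LR_norm D k n l)\<^sup>2" by (simp add: sum_nonneg)
  have "(\<Sum>A\<in>?S - {{}}. (planted_moment k n l A)\<^sup>2) \<le>
      (\<Sum>A\<in>?S - {{}}. of_bool (2 * card (snd ` A) \<le> card A) * t (fst ` A, snd ` A))"
  proof (intro sum_mono)
    fix A assume "A \<in> ?S - {{}}"
    then have "A \<subseteq> vertex_pairs k n" by (auto simp: small_sets_def)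
    from planted_moment_sq_le[OF assms(1-4) this]
    show "(planted_moment k n l A)\<^sup>2 \<le>
        of_bool (2 * card (snd ` A) \<le> card A) * t (fst ` A, snd ` A)"
      by (simp add: t_def q_def power_mult)
  qed
  also have "\<dots> = (\<Sum>A\<in>F. t (fst ` A, snd ` A))"
    by (intro sum.mono_neutral_cong_right) (use finS in \<open>auto simp: F_def\<close>)
  also have "\<dots> = (\<Sum>p\<in>TX \<times> TY. \<Sum>A\<in>{A\<in>F. (fst ` A, snd ` A) = p}. t (fst ` A, snd ` A))"
  proof (intro sum.group[symmetric] finF)
    show "(\<lambda>A. (fst ` A, snd ` A)) ` F \<subseteq> TX \<times> TY"
    proof safe
      fix A assume A: "A \<in> F"
      then have fin: "finite A" and sub: "A \<subseteq> vertex_pairs k n" and card: "card A \<le> D" "A \<noteq> {}"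
        "2 * card (snd ` A) \<le> card A"
        using finite_subset[OF _ finite_vertex_pairs] by (auto simp: F_def small_sets_def)
      show "fst ` A \<in> TX"
        using fin sub card card_image_le[OF fin, of fst]
        by (auto simp: TX_def vertex_pairs_def Suc_le_eq card_gt_0_iff)
      show "snd ` A \<in> TY" using sub card by (auto simp: TY_def vertex_pairs_def)
    qed
  qed (use finT in auto)
  also have "\<dots> \<le> (\<Sum>p\<in>TX \<times> TY. 2 ^ (D * D) * t p)"
  proof (intro sum_mono)
    fix p assume "p \<in> TX \<times> TY"
    then obtain X Y where p: "p = (X, Y)" and X: "X \<subseteq> {..<k}" "card X \<le> D"
      and Y: "Y \<subseteq> {..<n}" "card Y \<le> D"
      by (auto simp: TX_def TY_def)
    have fin: "finite X" "finite Y" using X Y finite_subset by blast+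
    \<comment> \<open>An edge set lies in the product of its touched vertex sets, so at most
      \<open>2 ^ (card X * card Y)\<close> edge sets share a pair.\<close>
    have "{A\<in>F. (fst ` A, snd ` A) = p} \<subseteq> Pow (X \<times> Y)"
      using fst_snd_image_subset_Times p by blast
    then have "card {A\<in>F. (fst ` A, snd ` A) = p} \<le> card (Pow (X \<times> Y))"
      using fin by (intro card_mono) auto
    also have "\<dots> = 2 ^ (card X * card Y)" using fin by (simp add: card_Pow card_cartesian_product)
    also have "\<dots> \<le> 2 ^ (D * D)" using X Y by (intro power_increasing mult_mono) auto
    finally have "real (card {A\<in>F. (fst ` A, snd ` A) = p}) \<le> real (2 ^ (D * D))"
      by (rule of_nat_mono)
    moreover have "(\<Sum>A\<in>{A\<in>F. (fst ` A, snd ` A) = p}. t (fst ` A, snd ` A)) =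
        (\<Sum>A\<in>{A\<in>F. (fst ` A, snd ` A) = p}. t p)"
      by (intro sum.cong) auto
    moreover have "0 \<le> t p" by (simp add: t_def p)
    ultimately show "(\<Sum>A\<in>{A\<in>F. (fst ` A, snd ` A) = p}. t (fst ` A, snd ` A)) \<le> 2 ^ (D * D) * t p"
      by (simp add: mult_right_mono)
  qed
  also have "\<dots> = 2 ^ (D * D) * ((\<Sum>X\<in>TX. ((real l / real k)\<^sup>2) ^ card X) * (\<Sum>Y\<in>TY. ((2 * q)\<^sup>2) ^ card Y))"
    unfolding sum_distrib_left[symmetric] by (simp only: sum_product sum.cartesian_product t_def)
  also have "\<dots> \<le> 2 ^ (D * D) * ((real D * x) * (real (D + 1) * y ^ (D div 2)))"
  proof (intro mult_left_mono mult_mono)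
    have x: "real k * (real l / real k)\<^sup>2 = x" "0 \<le> x" "x \<le> 1"
      using assms(2,5) by (auto simp: x_def power2_eq_square)
    have "(\<Sum>X\<in>TX. ((real l / real k)\<^sup>2) ^ card X) \<le> (\<Sum>a\<in>{1..D}. x ^ a)"
      using sum_subsets_power_le[of "{1..D}" "(real l / real k)\<^sup>2" k] x by (simp add: TX_def)
    \<comment> \<open>Since \<open>x \<le> 1\<close> and the exponents start at 1, the first power
      dominates.\<close>
    also have "\<dots> \<le> (\<Sum>a\<in>{1..D}. x ^ 1)"
      using x by (intro sum_mono power_decreasing) auto
    finally show "(\<Sum>X\<in>TX. ((real l / real k)\<^sup>2) ^ card X) \<le> real D * x" by simp
    have y1: "1 \<le> y" using assms(3,6) by (simp add: y_def)
    have "q \<le> real k / real n" by (simp add: q_def divide_right_mono)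
    then have "real n * (2 * q)\<^sup>2 \<le> real n * (2 * (real k / real n))\<^sup>2"
      using q by (intro mult_left_mono power_mono) auto
    also have "\<dots> = y" using assms(3) by (simp add: y_def power2_eq_square field_simps)
    finally have nq: "real n * (2 * q)\<^sup>2 \<le> y" .
    have "(\<Sum>Y\<in>TY. ((2 * q)\<^sup>2) ^ card Y) \<le> (\<Sum>b\<le>D div 2. (real n * (2 * q)\<^sup>2) ^ b)"
      using sum_subsets_power_le[of "{..D div 2}" "(2 * q)\<^sup>2" n] by (simp add: TY_def)
    \<comment> \<open>Since \<open>y \<ge> 1\<close>, the top power dominates.\<close>
    also have "\<dots> \<le> (\<Sum>b\<le>D div 2. y ^ (D div 2))"
    proof (intro sum_mono)
      fix b assume "b \<in> {..D div 2}"
      then have "y ^ b \<le> y ^ (D div 2)" using y1 by (intro power_increasing) auto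
      moreover have "(real n * (2 * q)\<^sup>2) ^ b \<le> y ^ b" using nq by (intro power_mono) auto
      ultimately show "(real n * (2 * q)\<^sup>2) ^ b \<le> y ^ (D div 2)" by linarith
    qed
    also have "\<dots> = real (D div 2 + 1) * y ^ (D div 2)" by simp
    also have "\<dots> \<le> real (D + 1) * y ^ (D div 2)"
      using y1 by (intro mult_right_mono) auto
    finally show "(\<Sum>Y\<in>TY. ((2 * q)\<^sup>2) ^ card Y) \<le> real (D + 1) * y ^ (D div 2)" .
  qed (use x_def in \<open>auto intro!: sum_nonneg\<close>)
  finally show "(low_degree_LR_norm D k n l)\<^sup>2 \<le>
    1 + 2 ^ (D * D) * (real D * ((real l)\<^sup>2 / real k)) *
      (real (D + 1) * (4 * (real k)\<^sup>2 / real n) ^ (D div 2))"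
    by (simp add: split x_def y_def mult.assoc)
qed

section \<open>Asymptotics in \<open>n\<close>\<close>

text \<open>A rounding error below 1 is absorbed because the real power is at least 8, and
  \<open>\<epsilon> \<le> 0.001\<close> keeps that power at most \<open>n powr 0.501\<close>, so at
  most \<open>n / 4\<close>. The bound \<open>2 * k n \<le> n\<close> supplies
  \<open>2 * (k - l) \<le> n\<close> for every \<open>l\<close>.\<close>

lemma eventually_scale_bounds:
  assumes "0 < \<epsilon>" "\<epsilon> \<le> 0.001"
    and "\<forall>\<^sub>F n in sequentially. \<bar>real (k n) - real n powr (1/2 + \<epsilon>)\<bar> < 1"
  shows "\<forall>\<^sub>F n in sequentially. 1 \<le> n \<and> 4 \<le> k n \<and> 2 * k n \<le> n \<and>
    real n powr (1/2 + \<epsilon>) / 2 \<le> real (k n) \<and> real (k n) \<le> 2 * real n powr (1/2 + \<epsilon>)"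
proof -
  have "\<forall>\<^sub>F n in sequentially. 8 \<le> real n powr (1/2)" by real_asymp
  moreover have "\<forall>\<^sub>F n in sequentially. 4 * real n powr 0.501 \<le> real n" by real_asymp
  ultimately show ?thesis
    using assms(3) eventually_ge_at_top[of 1]
  proof eventually_elim
    case (elim n)
    have "real n powr (1/2) \<le> real n powr (1/2 + \<epsilon>)" "real n powr (1/2 + \<epsilon>) \<le> real n powr 0.501"
      using assms(1,2) elim by (auto intro: powr_mono)
    with elim show ?case by linarith
  qed
qed

text \<open>The factor from U is of order at most \<open>n powr (- 0.002)\<close>, and the one from
  V of order at most \<open>n powr (D * \<epsilon>)\<close>. With
  \<open>D * \<epsilon> \<le> 0.001\<close> the excess over 1 is of order at most
  \<open>n powr (- 0.001)\<close>.\<close>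

lemma low_degree_LR_norm_tendsto_1:
  assumes "0 < \<epsilon>" "\<epsilon> \<le> 0.001" "real D * \<epsilon> \<le> 0.001"
    and "\<forall>\<^sub>F n in sequentially. \<bar>real (k n) - real n powr (1/2 + \<epsilon>)\<bar> < 1"
    and "\<forall>\<^sub>F n in sequentially. real (l n) \<le> real n powr (1/4 - 0.001)"
  shows "(\<lambda>n. low_degree_LR_norm D (k n) n (l n)) \<longlonglongrightarrow> 1"
proof -
  \<comment> \<open>Collects the constants: the 2 next to \<open>real D\<close> comes from
    \<open>k \<ge> N / 2\<close>, and 16 from \<open>4 * (2 * N)\<^sup>2\<close>.\<close>
  define c :: real where "c = 2 ^ (D * D) * (real D * 2) * (real (D + 1) * 16 ^ D)"
  \<comment> \<open>The exponent 0.498 is \<open>2 * (1/4 - 0.001)\<close>; together with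
    \<open>k \<ge> N / 2\<close> this gives \<open>l\<^sup>2 \<le> k\<close>.\<close>
  have small: "\<forall>\<^sub>F n in sequentially. real n powr 0.498 \<le> real n powr (1/2) / 2" by real_asymp
  have bounds: "\<forall>\<^sub>F n in sequentially. 1 \<le> (low_degree_LR_norm D (k n) n (l n))\<^sup>2 \<and>
      (low_degree_LR_norm D (k n) n (l n))\<^sup>2 \<le> 1 + c * real n powr (- 0.001)"
    using eventually_scale_bounds[OF assms(1,2,4)] assms(5) small
  proof eventually_elim
    case (elim n)
    define N where "N = real n powr (1/2 + \<epsilon>)"
    have n: "1 \<le> n" and k: "4 \<le> k n" "2 * k n \<le> n" "N / 2 \<le> real (k n)" "real (k n) \<le> 2 * N"
      using elim by (auto simp: N_def)
    have N: "real n powr (1/2) \<le> N" "0 < N" using n assms(1) by (auto simp: N_def intro: powr_mono)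
    have N2: "N\<^sup>2 = real n powr (1 + 2 * \<epsilon>)" unfolding N_def using n by (subst powr_power) (auto simp: algebra_simps)
    have "(real (l n))\<^sup>2 \<le> (real n powr (1/4 - 0.001))\<^sup>2" using elim by (intro power_mono) auto
    then have l2: "(real (l n))\<^sup>2 \<le> real n powr 0.498" using n by (simp add: powr_power)
    have lk2: "(real (l n))\<^sup>2 \<le> real (k n)" using l2 elim N k by linarith
    have lk: "l n \<le> k n"
    proof -
      have "l n \<le> (l n)\<^sup>2" by (simp add: power2_eq_square)
      then show ?thesis using lk2 by (simp flip: of_nat_power)
    qed
    have "real n = real n powr 1" by simp
    also have "\<dots> \<le> N\<^sup>2" unfolding N2 using n assms(1) by (intro powr_mono) auto
    also have "\<dots> = 4 * (N / 2)\<^sup>2" by (simp add: power2_eq_square)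
    also have "\<dots> \<le> 4 * (real (k n))\<^sup>2" using k N by (intro mult_left_mono power_mono) auto
    finally have nk: "real n \<le> 4 * (real (k n))\<^sup>2" .
    have "2 * (k n - l n) \<le> n" using k by linarith
    note norm = low_degree_LR_norm_sq_le[OF lk _ _ this lk2 nk, of D]
    have x: "(real (l n))\<^sup>2 / real (k n) \<le> 2 * real n powr (- 0.002)"
    proof -
      have "(real (l n))\<^sup>2 / real (k n) \<le> real n powr 0.498 / (real n powr (1/2) / 2)"
        using l2 k N n by (intro frac_le) auto
      also have "\<dots> = 2 * real n powr (0.498 - 1/2)" unfolding powr_diff by simp
      finally show ?thesis by simp
    qed
    have y: "(4 * (real (k n))\<^sup>2 / real n) ^ (D div 2) \<le> 16 ^ D * real n powr 0.001"
    proof -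
      have "4 * (real (k n))\<^sup>2 / real n \<le> 4 * (2 * N)\<^sup>2 / real n"
        using k n by (intro divide_right_mono mult_left_mono power_mono) auto
      also have "\<dots> = 16 * (N\<^sup>2 / real n)" by (simp add: power_mult_distrib)
      also have "N\<^sup>2 / real n = real n powr (2 * \<epsilon>)" using n by (simp add: N2 powr_add)
      finally have "(4 * (real (k n))\<^sup>2 / real n) ^ (D div 2) \<le> (16 * real n powr (2 * \<epsilon>)) ^ (D div 2)"
        by (intro power_mono) auto
      also have "\<dots> = 16 ^ (D div 2) * real n powr (real (D div 2) * (2 * \<epsilon>))"
        using n by (simp add: power_mult_distrib powr_power mult_ac)
      also have "\<dots> \<le> 16 ^ D * real n powr 0.001"
      proof (intro mult_mono powr_mono power_increasing)
        have "real (D div 2) * 2 \<le> real D" by linarith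
        then have "real (D div 2) * 2 * \<epsilon> \<le> real D * \<epsilon>" using assms(1) by (intro mult_right_mono) auto
        then show "real (D div 2) * (2 * \<epsilon>) \<le> 0.001" using assms(3) by linarith
      qed (use n in auto)
      finally show ?thesis .
    qed
    have "(low_degree_LR_norm D (k n) n (l n))\<^sup>2 \<le>
      1 + 2 ^ (D * D) * (real D * ((real (l n))\<^sup>2 / real (k n))) *
      (real (D + 1) * (4 * (real (k n))\<^sup>2 / real n) ^ (D div 2))"
      using norm(1) k n by simp
    also have "\<dots> \<le> 1 + 2 ^ (D * D) * (real D * (2 * real n powr (- 0.002))) *
      (real (D + 1) * (16 ^ D * real n powr 0.001))"
      using x y by (intro add_left_mono mult_mono) auto
    also have "\<dots> = 1 + c * (real n powr (- 0.002) * real n powr 0.001)" by (simp add: c_def mult_ac)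
    also have "real n powr (- 0.002) * real n powr 0.001 = real n powr (- 0.001)" by (simp flip: powr_add)
    finally show ?case using norm(2) k n by simp
  qed
  have "(\<lambda>n. real n powr (- 0.001)) \<longlonglongrightarrow> 0" by real_asymp
  then have lim: "(\<lambda>n. 1 + c * real n powr (- 0.001)) \<longlonglongrightarrow> 1"
    using tendsto_add[OF tendsto_const tendsto_mult_left] by fastforce
  have "(\<lambda>n. (low_degree_LR_norm D (k n) n (l n))\<^sup>2) \<longlonglongrightarrow> 1"
    by (rule tendsto_sandwich[OF _ _ tendsto_const lim]) (use bounds in \<open>auto elim: eventually_mono\<close>)
  then have "(\<lambda>n. sqrt ((low_degree_LR_norm D (k n) n (l n))\<^sup>2)) \<longlonglongrightarrow> sqrt 1"
    by (rule tendsto_real_sqrt)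
  then show ?thesis by (simp add: low_degree_LR_norm_eq sum_nonneg)
qed

text \<open>Both regimes of \<open>l\<close> give the same bound \<open>n powr 0.998 / c\<close> on
  the squared norm, so \<open>l\<close> may switch between them as \<open>n\<close> varies.\<close>

lemma low_degree_LR_norm_at_top:
  assumes "0 < \<epsilon>" "\<epsilon> \<le> 0.001" "3 / \<epsilon> \<le> real D + 1"
    and "\<forall>\<^sub>F n in sequentially. \<bar>real (k n) - real n powr (1/2 + \<epsilon>)\<bar> < 1"
    and "\<forall>\<^sub>F n in sequentially. 1 \<le> l n \<and> l n < k n"
  shows "filterlim (\<lambda>n. low_degree_LR_norm D (k n) n (l n)) at_top sequentially"
proof -
  \<comment> \<open>Chosen so that \<open>\<epsilon> * b \<ge> 1\<close>, which lifts
    \<open>n powr (2 * \<epsilon> * b)\<close> to at least \<open>n powr 2\<close>.\<close>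
  define b where "b = nat \<lceil>1 / \<epsilon>\<rceil>"
  \<comment> \<open>Dominates both constants: \<open>2 ^ 20\<close> for sides (4, 1) and
    \<open>16 * (16 * b) ^ b\<close> for sides (2, b).\<close>
  define c :: real where "c = 2 ^ 20 * (16 * real b) ^ b"
  have "1000 \<le> 1 / \<epsilon>" using assms(1,2) by (simp add: field_simps)
  then have b_ge: "1 / \<epsilon> \<le> real b" and b_le: "real b \<le> 1 / \<epsilon> + 1" and b1: "1 \<le> b"
    unfolding b_def by linarith+
  have "3 / \<epsilon> = 3 * (1 / \<epsilon>)" by simp
  \<comment> \<open>Room comes from \<open>1 / \<epsilon> \<ge> 1000\<close>:
    \<open>2 * b + 2 \<le> 2 / \<epsilon> + 4 \<le> 3 / \<epsilon>\<close>.\<close>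
  then have "2 * real b + 2 \<le> real D + 1" "4 + 1 \<le> real D + 1"
    using assms(3) b_le \<open>1000 \<le> 1 / \<epsilon>\<close> by linarith+
  then have D: "2 * b \<le> D" "4 * 1 \<le> D" by linarith+
  have eb: "1 \<le> \<epsilon> * real b" using b_ge assms(1) by (simp add: field_simps)
  have "1 \<le> (16 * real b) ^ b" using b1 by (intro one_le_power) auto
  then have c: "2 ^ 20 \<le> c" "0 < c" "16 * (16 * real b) ^ b \<le> c" by (auto simp: c_def)
  have "\<forall>\<^sub>F n in sequentially. sqrt (real n powr 0.998 / c) \<le> low_degree_LR_norm D (k n) n (l n)"
    using eventually_scale_bounds[OF assms(1,2,4)] assms(5) eventually_ge_at_top[of b]
  proof eventually_elim
    case (elim n)
    define N where "N = real n powr (1/2 + \<epsilon>)"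
    have n: "1 \<le> n" "b \<le> n" and k: "4 \<le> k n" "2 * k n \<le> n" "N / 2 \<le> real (k n)" "real (k n) \<le> 2 * N"
      and l: "1 \<le> l n" "l n < k n"
      using elim by (auto simp: N_def)
    have N: "real n powr (1/2) \<le> N" "0 < N" using n assms(1) by (auto simp: N_def intro: powr_mono)
    have N2: "N\<^sup>2 = real n powr (1 + 2 * \<epsilon>)" unfolding N_def using n by (subst powr_power) (auto simp: algebra_simps)
    have kl: "2 * (k n - l n) \<le> n" using k by linarith
    note ge = low_degree_LR_norm_ge[OF less_imp_le[OF l(2)] _ _ kl]
    have "real n powr 0.998 / c \<le> (low_degree_LR_norm D (k n) n (l n))\<^sup>2"
    proof (cases "k n \<le> 2 * l n")
      case True
      \<comment> \<open>Sides (4, 1): here \<open>l / k \<ge> 1/2\<close>, and \<open>l < k\<close>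
        between integers yields \<open>q \<ge> 1 / n\<close>. As \<open>k\<close> is at least of
        order \<open>sqrt n\<close>, the quantity \<open>k ^ 4 * n / n ^ 2\<close> is at least of
        order \<open>n\<close>; the constant is \<open>2 ^ 20 = 8 ^ 4 * 2 ^ 8\<close>.\<close>
      have "real n powr 0.998 / c \<le> real n powr 1 / 2 ^ 20"
        using c n by (intro frac_le powr_mono) auto
      also have "\<dots> = ((real n powr (1/2) / 2) / 4) ^ 4 * real n * (1/2) ^ 8 * (1 / real n) ^ 2"
      proof -
        have "(real n powr (1/2)) ^ 4 = real n ^ 2" using n by (simp add: powr_power powr_numeral)
        then show ?thesis using n by (simp add: power_divide power2_eq_square)
      qed
      also have "\<dots> \<le> (real (k n) / 4) ^ 4 * real n * (real (l n) / real (k n)) ^ 8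
          * ((real (k n) - real (l n)) / real n) ^ 2"
        using k l N n True by (intro mult_mono power_mono divide_right_mono) (auto simp: field_simps)
      also have "\<dots> \<le> real (k n choose 4) * real (n choose 1) * (real (l n) / real (k n)) ^ (2 * 4)
          * ((real (k n) - real (l n)) / real n) ^ (2 * 1)"
        using binomial_ge_n_over_k_pow_k[of 4 "k n", where ?'a=real] k
        by (simp add: mult_right_mono)
      also have "\<dots> \<le> (low_degree_LR_norm D (k n) n (l n))\<^sup>2"
        by (rule ge) (use k n D in auto)
      finally show ?thesis .
    next
      case False
      \<comment> \<open>Sides (2, b): \<open>l < k / 2\<close> gives
        \<open>q \<ge> k / (2 * n)\<close>, and \<open>l \<ge> 1\<close> gives
        \<open>l / k \<ge> 1 / k\<close>. The left side costs a factor of order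
        \<open>k\<^sup>2\<close>, which the \<open>b\<close> right vertices repay.\<close>
      let ?k = "real (k n)"
      have k0: "0 < ?k" "0 < real n" "0 < real b" using k n b1 by auto
      have frac: "?k / 2 / real n \<le> (?k - real (l n)) / real n"
        using False by (intro divide_right_mono) auto
      have "real n powr 0.998 / c \<le> real n powr (2 - (1 + 2 * \<epsilon>)) / (16 * (16 * real b) ^ b)"
        using c n b1 assms(2) by (intro frac_le powr_mono) auto
      also have "\<dots> \<le> real n powr (2 * \<epsilon> * real b - (1 + 2 * \<epsilon>)) / (16 * (16 * real b) ^ b)"
        using n eb by (intro divide_right_mono powr_mono) auto
      also have "\<dots> = 1 / (4 * (2 * N)\<^sup>2) * (real n powr (2 * \<epsilon>) / (16 * real b)) ^ b"
      proof -
        have "real n powr (2 * \<epsilon> * real b) = (real n powr (2 * \<epsilon>)) ^ b"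
          using n by (subst powr_power) (auto simp: mult_ac)
        then show ?thesis by (simp add: powr_diff N2 power_mult_distrib power_divide)
      qed
      also have "\<dots> \<le> 1 / (4 * ?k\<^sup>2) * (?k\<^sup>2 / (4 * real b * real n)) ^ b"
      proof (intro mult_mono power_mono)
        show "1 / (4 * (2 * N)\<^sup>2) \<le> 1 / (4 * ?k\<^sup>2)"
          using k N k0 by (intro divide_left_mono mult_left_mono power_mono) auto
        have "real n powr (2 * \<epsilon>) * real n = N\<^sup>2"
          using n by (simp add: N2 powr_add)
        then have "real n powr (2 * \<epsilon>) / (16 * real b) = (N / 2)\<^sup>2 / (4 * real b * real n)"
          using k0 by (simp add: field_simps)
        also have "\<dots> \<le> ?k\<^sup>2 / (4 * real b * real n)"
          using k N by (intro divide_right_mono power_mono) auto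
        finally show "real n powr (2 * \<epsilon>) / (16 * real b) \<le> ?k\<^sup>2 / (4 * real b * real n)" .
      qed auto
      \<comment> \<open>Regrouped so that each factor meets its counterpart in the lower bound, the
        binomials being at least \<open>(k / 2) ^ 2\<close> and \<open>(n / b) ^ b\<close>.\<close>
      also have "\<dots> = (?k / 2) ^ 2 * (real n / real b) ^ b * (1 / ?k) ^ 4 * (?k / 2 / real n) ^ (2 * b)"
      proof -
        have "?k\<^sup>2 / (4 * real b * real n) = (real n / real b) * (?k / 2 / real n) ^ 2"
          using k0 by (simp add: power2_eq_square field_simps)
        moreover have "1 / (4 * ?k\<^sup>2) = (?k / 2) ^ 2 * (1 / ?k) ^ 4"
          using k0 by (simp add: field_simps power2_eq_square power4_eq_xxxx)
        ultimately have "1 / (4 * ?k\<^sup>2) * (?k\<^sup>2 / (4 * real b * real n)) ^ b =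
            (?k / 2) ^ 2 * (1 / ?k) ^ 4 * ((real n / real b) ^ b * ((?k / 2 / real n) ^ 2) ^ b)"
          by (simp only: power_mult_distrib)
        then show ?thesis unfolding power_mult by (simp add: ac_simps)
      qed
      also have "\<dots> \<le> real (k n choose 2) * real (n choose b) * (real (l n) / ?k) ^ (2 * 2)
          * ((?k - real (l n)) / real n) ^ (2 * b)"
        using binomial_ge_n_over_k_pow_k[of 2 "k n", where ?'a=real]
          binomial_ge_n_over_k_pow_k[of b n, where ?'a=real] k n l
        by (intro mult_mono power_mono[OF frac]) (auto intro!: power_mono divide_right_mono)
      also have "\<dots> \<le> (low_degree_LR_norm D (k n) n (l n))\<^sup>2"
        by (rule ge) (use k n D b1 in auto)
      finally show ?thesis .
    qed
    from real_sqrt_le_mono[OF this] show ?case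
      by (simp add: low_degree_LR_norm_eq sum_nonneg)
  qed
  moreover have "filterlim (\<lambda>n. sqrt (real n powr 0.998 / c)) at_top sequentially"
    using c(2) by real_asymp
  ultimately show ?thesis by (rule filterlim_at_top_mono[rotated])
qed

text \<open>The condition on \<open>k\<close> admits rounding the real power down or up.
  \<open>O(1/\<epsilon>)\<close> becomes an absolute threshold \<open>C\<^sub>0\<close>, independent
  of \<open>\<epsilon>\<close>, above which every constant works. The second range of
  \<open>l\<close> leaves out \<open>l = 0\<close> and \<open>l = k\<close>, where the planted
  distribution is the null one.\<close>

theorem mainTheorem3:
  shows
    "(\<forall>(\<epsilon>::real) (k::nat \<Rightarrow> nat) (l::nat \<Rightarrow> nat).
        0 < \<epsilon> \<and> \<epsilon> \<le> 0.001 \<and>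
        (\<forall>\<^sub>F n in sequentially. \<bar>real (k n) - real n powr (1/2 + \<epsilon>)\<bar> < 1) \<and>
        (\<forall>\<^sub>F n in sequentially. real (l n) \<le> real n powr (1/4 - 0.001)) \<longrightarrow>
        (\<lambda>n. low_degree_LR_norm (nat \<lfloor>0.001 / \<epsilon>\<rfloor>) (k n) n (l n)) \<longlonglongrightarrow> 1)
     \<and>
     (\<exists>C\<^sub>0>0. \<forall>C\<ge>C\<^sub>0. \<forall>(\<epsilon>::real) (k::nat \<Rightarrow> nat) (l::nat \<Rightarrow> nat).
        0 < \<epsilon> \<and> \<epsilon> \<le> 0.001 \<and>
        (\<forall>\<^sub>F n in sequentially. \<bar>real (k n) - real n powr (1/2 + \<epsilon>)\<bar> < 1) \<and>
        (\<forall>\<^sub>F n in sequentially. 1 \<le> l n \<and> l n < k n) \<longrightarrow>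
        filterlim (\<lambda>n. low_degree_LR_norm (nat \<lfloor>C / \<epsilon>\<rfloor>) (k n) n (l n)) at_top sequentially)"
proof (intro conjI allI impI; (elim conjE)?)
  fix \<epsilon> :: real and k l :: "nat \<Rightarrow> nat"
  assume eps: "0 < \<epsilon>" "\<epsilon> \<le> 0.001"
    and "\<forall>\<^sub>F n in sequentially. \<bar>real (k n) - real n powr (1/2 + \<epsilon>)\<bar> < 1"
    and "\<forall>\<^sub>F n in sequentially. real (l n) \<le> real n powr (1/4 - 0.001)"
  moreover have "real (nat \<lfloor>0.001 / \<epsilon>\<rfloor>) \<le> 0.001 / \<epsilon>" using eps(1) by (intro of_nat_floor) auto
  then have "real (nat \<lfloor>0.001 / \<epsilon>\<rfloor>) * \<epsilon> \<le> 0.001" using eps(1) by (simp only: pos_le_divide_eq)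
  ultimately show "(\<lambda>n. low_degree_LR_norm (nat \<lfloor>0.001 / \<epsilon>\<rfloor>) (k n) n (l n)) \<longlonglongrightarrow> 1"
    by (intro low_degree_LR_norm_tendsto_1)
next
  have "filterlim (\<lambda>n. low_degree_LR_norm (nat \<lfloor>C / \<epsilon>\<rfloor>) (k n) n (l n)) at_top sequentially"
    if "3 \<le> C" "0 < \<epsilon>" "\<epsilon> \<le> 0.001"
      "\<forall>\<^sub>F n in sequentially. \<bar>real (k n) - real n powr (1/2 + \<epsilon>)\<bar> < 1"
      "\<forall>\<^sub>F n in sequentially. 1 \<le> l n \<and> l n < k n" for C \<epsilon> :: real and k l
  proof (rule low_degree_LR_norm_at_top[OF that(2,3) _ that(4,5)])
    have "3 / \<epsilon> \<le> C / \<epsilon>" using that by (intro divide_right_mono) auto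
    \<comment> \<open>Rounding \<open>C / \<epsilon>\<close> down loses less than 1, hence the
      \<open>+ 1\<close> in the degree condition.\<close>
    then show "3 / \<epsilon> \<le> real (nat \<lfloor>C / \<epsilon>\<rfloor>) + 1" by linarith
  qed
  then show "\<exists>C\<^sub>0>0. \<forall>C\<ge>C\<^sub>0. \<forall>(\<epsilon>::real) (k::nat \<Rightarrow> nat) (l::nat \<Rightarrow> nat).
        0 < \<epsilon> \<and> \<epsilon> \<le> 0.001 \<and>
        (\<forall>\<^sub>F n in sequentially. \<bar>real (k n) - real n powr (1/2 + \<epsilon>)\<bar> < 1) \<and>
        (\<forall>\<^sub>F n in sequentially. 1 \<le> l n \<and> l n < k n) \<longrightarrow>
        filterlim (\<lambda>n. low_degree_LR_norm (nat \<lfloor>C / \<epsilon>\<rfloor>) (k n) n (l n)) at_top sequentially"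
    by (intro exI[of _ 3]) auto
qed

end
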